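(* Let $\epsilon\in(0,\frac{2}{5})$, let $\tau$ be a positive integer, and let $\Gamma$ be a $D$-regular graph on vertex set $[n]$. Suppose that $\|Q^{\tau}_v-U\|<\frac{1}{30}$ for at least $\epsilon n$ vertices $v\in[n]$. Then $\Gamma$ contains a cycle of length $\ell>\frac{\epsilon n}{40\tau}$, and there is a deterministic polynomial-time algorithm that finds such a cycle in $\Gamma$.
   Context: All graphs are finite simple graphs; $D\ge 1$. For a $D$-regular graph $\Gamma$ on $[n]$, the random walk moves at each step to a uniformly random neighbor of the current vertex, independently of the history; $Q^t_v$ denotes the distribution of the position after $t$ steps of the walk started at $v$. $U$ is the uniform distribution on $[n]$, and $\|P_1-P_2\|=\max_{A\subseteq[n]}|P_1(A)-P_2(A)|$ is the total variation distance. *)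

theory Defs
  imports "HOL-Probability.Probability" "HOL-Computational_Algebra.Polynomial"
begin

text \<open>
  A graph on \<open>{1..n}\<close> is given by its adjacency relation \<open>E\<close>, as a set of ordered pairs;
  the neighbours of \<open>v\<close> are \<open>E `` {v}\<close>.
\<close>

definition simple_graph :: "nat \<Rightarrow> (nat \<times> nat) set \<Rightarrow> bool" where
  "simple_graph n E \<longleftrightarrow> E \<subseteq> {1..n} \<times> {1..n} \<and> sym E \<and> irrefl E"

definition regular_graph :: "nat \<Rightarrow> nat \<Rightarrow> (nat \<times> nat) set \<Rightarrow> bool" where
  "regular_graph n D E \<longleftrightarrow> simple_graph n E \<and> (\<forall>v\<in>{1..n}. card (E `` {v}) = D)"

definition is_cycle :: "(nat \<times> nat) set \<Rightarrow> nat list \<Rightarrow> bool" where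
  "is_cycle E xs \<longleftrightarrow> 3 \<le> length xs \<and> distinct xs \<and>
     (\<forall>i<length xs. (xs ! i, xs ! (Suc i mod length xs)) \<in> E)"

primrec walk :: "(nat \<times> nat) set \<Rightarrow> nat \<Rightarrow> nat \<Rightarrow> nat pmf" where
  "walk E 0 v = return_pmf v"
| "walk E (Suc t) v = bind_pmf (walk E t v) (\<lambda>u. pmf_of_set (E `` {u}))"

definition tv_dist :: "nat \<Rightarrow> nat pmf \<Rightarrow> nat pmf \<Rightarrow> real" where
  "tv_dist n P1 P2 =
     Max ((\<lambda>A. \<bar>measure_pmf.prob P1 A - measure_pmf.prob P2 A\<bar>) ` Pow {1..n})"

text \<open>
  Algorithms are structured programs for a random access machine: finitely many registers are
  mentioned by a program, the memory is indirectly addressed, and all cells hold natural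
  numbers. Every elementary operation has unit cost. As the only arithmetic operations are addition
  and truncated subtraction (no multiplication), the numbers occurring in \<open>t\<close> steps have \<open>O(t)\<close> bits more
  than those in the input, so polynomial time here is polynomial time on Turing machines.
\<close>

datatype aexp =
    AConst nat
  | AReg nat
  | AMem aexp
  | AAdd aexp aexp
  | ASub aexp aexp

datatype bexp =
    BLess aexp aexp
  | BEq aexp aexp
  | BNot bexp
  | BAnd bexp bexp

datatype com =
    CSkip
  | CSet nat aexp
  | CStore aexp aexp
  | CSeq com com
  | CIf bexp com com
  | CWhile bexp com

text \<open>A state consists of the register contents and the memory contents.\<close>

type_synonym state = "(nat \<Rightarrow> nat) \<times> (nat \<Rightarrow> nat)"

primrec aval :: "aexp \<Rightarrow> state \<Rightarrow> nat" where
  "aval (AConst k) s = k"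
| "aval (AReg r) s = fst s r"
| "aval (AMem a) s = snd s (aval a s)"
| "aval (AAdd a b) s = aval a s + aval b s"
| "aval (ASub a b) s = aval a s - aval b s"

primrec acost :: "aexp \<Rightarrow> nat" where
  "acost (AConst k) = 1"
| "acost (AReg r) = 1"
| "acost (AMem a) = acost a + 1"
| "acost (AAdd a b) = acost a + acost b + 1"
| "acost (ASub a b) = acost a + acost b + 1"

primrec bval :: "bexp \<Rightarrow> state \<Rightarrow> bool" where
  "bval (BLess a b) s \<longleftrightarrow> aval a s < aval b s"
| "bval (BEq a b) s \<longleftrightarrow> aval a s = aval b s"
| "bval (BNot b) s \<longleftrightarrow> \<not> bval b s"
| "bval (BAnd b c) s \<longleftrightarrow> bval b s \<and> bval c s"

primrec bcost :: "bexp \<Rightarrow> nat" where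
  "bcost (BLess a b) = acost a + acost b + 1"
| "bcost (BEq a b) = acost a + acost b + 1"
| "bcost (BNot b) = bcost b + 1"
| "bcost (BAnd b c) = bcost b + bcost c + 1"

text \<open>\<open>exec c s t s'\<close>: started in state \<open>s\<close>, the program \<open>c\<close> halts in state \<open>s'\<close> after time \<open>t\<close>.\<close>

inductive exec :: "com \<Rightarrow> state \<Rightarrow> nat \<Rightarrow> state \<Rightarrow> bool" where
  Skip: "exec CSkip s 1 s"
| Set: "exec (CSet r a) s (acost a + 1) ((fst s)(r := aval a s), snd s)"
| Store: "exec (CStore a b) s (acost a + acost b + 1) (fst s, (snd s)(aval a s := aval b s))"
| Seq: "exec c1 s t1 s1 \<Longrightarrow> exec c2 s1 t2 s2 \<Longrightarrow> exec (CSeq c1 c2) s (t1 + t2) s2"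
| IfTrue: "bval b s \<Longrightarrow> exec c1 s t s' \<Longrightarrow> exec (CIf b c1 c2) s (bcost b + t + 1) s'"
| IfFalse: "\<not> bval b s \<Longrightarrow> exec c2 s t s' \<Longrightarrow> exec (CIf b c1 c2) s (bcost b + t + 1) s'"
| WhileFalse: "\<not> bval b s \<Longrightarrow> exec (CWhile b c) s (bcost b + 1) s"
| WhileTrue: "bval b s \<Longrightarrow> exec c s t1 s1 \<Longrightarrow> exec (CWhile b c) s1 t2 s2 \<Longrightarrow>
    exec (CWhile b c) s (bcost b + t1 + t2 + 1) s2"

inductive_cases Skip_elim: "exec CSkip s t s'"
inductive_cases Set_elim: "exec (CSet r a) s t s'"
inductive_cases Store_elim: "exec (CStore a b) s t s'"
inductive_cases Seq_elim: "exec (CSeq c1 c2) s t s'"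
inductive_cases If_elim: "exec (CIf b c1 c2) s t s'"
inductive_cases While_elim: "exec (CWhile b c) s t s'"

lemma exec_deterministic:
  "exec c s t s' \<Longrightarrow> exec c s u s'' \<Longrightarrow> t = u \<and> s' = s''"
proof (induction arbitrary: u s'' rule: exec.induct)
  case (Skip s)
  show ?case by (rule Skip_elim[OF Skip]) simp
next
  case (Set r a s)
  show ?case by (rule Set_elim[OF Set]) simp
next
  case (Store a b s)
  show ?case by (rule Store_elim[OF Store]) simp
next
  case (Seq c1 s t1 s1 c2 t2 s2)
  show ?case
  proof (rule Seq_elim[OF Seq.prems])
    fix u1 v1 u2
    assume u: "u = u1 + u2" and 1: "exec c1 s u1 v1" and 2: "exec c2 v1 u2 s''"
    have "t1 = u1" "s1 = v1" using Seq.IH(1)[OF 1] by simp_all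
    with u Seq.IH(2) 2 show ?thesis by simp
  qed
next
  case (IfTrue b s c1 t s' c2)
  show ?case
  proof (rule If_elim[OF IfTrue.prems])
    fix v assume "u = Suc (bcost b + v)" "exec c1 s v s''"
    with IfTrue.IH[of v s''] show ?thesis by simp
  qed (use IfTrue.hyps(1) in simp)
next
  case (IfFalse b s c2 t s' c1)
  show ?case
  proof (rule If_elim[OF IfFalse.prems])
    fix v assume "u = Suc (bcost b + v)" "exec c2 s v s''"
    with IfFalse.IH[of v s''] show ?thesis by simp
  qed (use IfFalse.hyps(1) in simp)
next
  case (WhileFalse b s c)
  show ?case
    by (rule While_elim[OF WhileFalse.prems]) (use WhileFalse.hyps in simp_all)
next
  case (WhileTrue b s c t1 s1 t2 s2)
  show ?case
  proof (rule While_elim[OF WhileTrue.prems])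
    fix u1 v1 u2
    assume u: "u = Suc (bcost b + u1 + u2)" and 1: "exec c s u1 v1"
      and 2: "exec (CWhile b c) v1 u2 s''"
    have "t1 = u1" "s1 = v1" using WhileTrue.IH(1)[OF 1] by simp_all
    with u WhileTrue.IH(2) 2 show ?thesis by simp
  qed (use WhileTrue.hyps(1) in simp)
qed

text \<open>
  Input: register 0 holds \<open>n\<close>, and the memory holds the adjacency matrix row by row
  from address 0 on. All other registers and memory cells are 0.
  Output: a list of numbers, whose length is in register 0 and which is stored in consecutive
  memory cells from the address in register 1 on.
\<close>

definition graph_input :: "nat \<Rightarrow> (nat \<times> nat) set \<Rightarrow> state" where
  "graph_input n E =
     ((\<lambda>r. if r = 0 then n else 0),
      (\<lambda>a. if a < n * n \<and> (a div n + 1, a mod n + 1) \<in> E then 1 else 0))"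

definition list_output :: "state \<Rightarrow> nat list" where
  "list_output s = map (\<lambda>i. snd s (fst s 1 + i)) [0..<fst s 0]"

definition returns :: "com \<Rightarrow> nat \<Rightarrow> (nat \<times> nat) set \<Rightarrow> nat list \<Rightarrow> bool" where
  "returns P n E xs \<longleftrightarrow> (\<exists>t s. exec P (graph_input n E) t s \<and> list_output s = xs)"

definition polynomial_time :: "com \<Rightarrow> bool" where
  "polynomial_time P \<longleftrightarrow> (\<exists>p :: nat poly. \<forall>n E. simple_graph n E \<longrightarrow>
     (\<exists>t s. exec P (graph_input n E) t s \<and> t \<le> poly p n))"

end

theory Submission
  imports Defs
begin

text \<open>
  Run a depth-first search. Every edge joins a vertex to one of its ancestors, so an edge spanning
  \<open>b\<close> levels closes a cycle of length \<open>b + 1\<close>; the algorithm returns a cycle for the largest \<open>b\<close>.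
  Removing the \<open>b\<close> lowest vertices of the root path of any vertex \<open>c\<close> (including \<open>c\<close>) separates
  the subtrees below \<open>c\<close> from each other and from the rest. For a centroid \<open>c\<close> this
  gives a set \<open>S\<close> of at most \<open>b\<close> vertices such that every component of the rest has at most \<open>n/2\<close> vertices.
  A walk that is well mixed after \<open>\<tau>\<close> steps has to leave its component, hence visits \<open>S\<close> at least
  \<open>1/3\<close> times in expectation. But summed over all starting points, the expected number of
  visits to \<open>S\<close> is \<open>\<tau> |S|\<close>, because the uniform distribution is stationary. Therefore \<open>b\<close> is
  of order \<open>\<epsilon> n / \<tau>\<close>.
\<close>

section \<open>Random walks on regular graphs\<close>

lemma set_pmf_step:
  assumes "regular_graph n D E" "1 \<le> D" "u \<in> {1..n}"
  shows "set_pmf (pmf_of_set (E `` {u})) = E `` {u}" "finite (E `` {u})" "E `` {u} \<noteq> {}"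
    "E `` {u} \<subseteq> {1..n}" "card (E `` {u}) = D"
proof -
  show sub: "E `` {u} \<subseteq> {1..n}" and card: "card (E `` {u}) = D"
    using assms by (auto simp: regular_graph_def simple_graph_def)
  show fin: "finite (E `` {u})" using sub finite_subset by blast
  show ne: "E `` {u} \<noteq> {}" using card assms(2) by force
  show "set_pmf (pmf_of_set (E `` {u})) = E `` {u}" using fin ne by simp
qed

lemma set_pmf_walk:
  assumes "regular_graph n D E" "1 \<le> D" "v \<in> {1..n}"
  shows "set_pmf (walk E t v) \<subseteq> {1..n}"
proof (induction t)
  case 0
  then show ?case using assms by simp
next
  case (Suc t)
  have "set_pmf (pmf_of_set (E `` {u})) \<subseteq> {1..n}" if "u \<in> set_pmf (walk E t v)" for u
    using set_pmf_step(1,4)[OF assms(1,2) subsetD[OF Suc that]] by simp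
  then show ?case by (simp add: UN_subset_iff)
qed

lemma prob_bind_pmf:
  "measure_pmf.prob (bind_pmf M f) B = measure_pmf.expectation M (\<lambda>x. measure_pmf.prob (f x) B)"
proof -
  have "ennreal (measure_pmf.prob (bind_pmf M f) B) = (\<integral>\<^sup>+x. ennreal (measure_pmf.prob (f x) B) \<partial>M)"
    unfolding measure_pmf.emeasure_eq_measure[symmetric] by simp
  also have "\<dots> = ennreal (measure_pmf.expectation M (\<lambda>x. measure_pmf.prob (f x) B))"
    by (intro nn_integral_eq_integral measure_pmf.integrable_const_bound[where B=1]) auto
  finally show ?thesis by (simp add: integral_nonneg)
qed

lemma walk_Suc_sum:
  assumes "regular_graph n D E" "1 \<le> D" "v \<in> {1..n}"
  shows "measure_pmf.prob (walk E (Suc t) v) B =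
    (\<Sum>u\<in>{1..n}. pmf (walk E t v) u * measure_pmf.prob (pmf_of_set (E `` {u})) B)"
proof -
  have "measure_pmf.prob (walk E (Suc t) v) B =
      measure_pmf.expectation (walk E t v) (\<lambda>u. measure_pmf.prob (pmf_of_set (E `` {u})) B)"
    by (simp add: prob_bind_pmf)
  also have "\<dots> = (\<Sum>u\<in>{1..n}. pmf (walk E t v) u * measure_pmf.prob (pmf_of_set (E `` {u})) B)"
    using set_pmf_walk[OF assms, of t]
    by (subst integral_measure_pmf_real[of "{1..n}"]) (auto simp: mult.commute)
  finally show ?thesis .
qed

lemma prob_walk_sum:
  assumes "regular_graph n D E" "1 \<le> D" "v \<in> {1..n}"
  shows "measure_pmf.prob (walk E t v) B = (\<Sum>u\<in>{1..n}. pmf (walk E t v) u * indicator B u)"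
proof -
  have "measure_pmf.prob (walk E t v) B = measure_pmf.prob (walk E t v) ({1..n} \<inter> B)"
    using set_pmf_walk[OF assms, of t]
    by (intro measure_pmf.finite_measure_eq_AE) (auto simp: AE_measure_pmf_iff)
  also have "\<dots> = (\<Sum>u\<in>{1..n}. if u \<in> B then pmf (walk E t v) u else 0)"
    by (simp add: measure_measure_pmf_finite sum.inter_restrict)
  also have "\<dots> = (\<Sum>u\<in>{1..n}. pmf (walk E t v) u * indicator B u)"
    by (intro sum.cong) auto
  finally show ?thesis .
qed

text \<open>The transition matrix is symmetric: its entry at \<open>u\<close>, \<open>x\<close> is
  \<open>1 / D\<close> exactly when \<open>u\<close> is one of the \<open>D\<close> neighbours of
  \<open>x\<close>. Hence its columns also sum to 1, and powers inherit this by conditioning on the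
  last step.\<close>

lemma walk_doubly_stochastic:
  assumes "regular_graph n D E" "1 \<le> D" "x \<in> {1..n}"
  shows "(\<Sum>v\<in>{1..n}. pmf (walk E t v) x) = 1"
  using assms(3)
proof (induction t arbitrary: x)
  case 0
  then show ?case by (simp add: pmf_return indicator_def sum.delta)
next
  case (Suc t)
  have step: "measure_pmf.prob (pmf_of_set (E `` {u})) {x} = indicator (E `` {x}) u / D"
    if "u \<in> {1..n}" for u
  proof -
    have "(u, x) \<in> E \<longleftrightarrow> (x, u) \<in> E"
      using assms(1) by (auto simp: regular_graph_def simple_graph_def sym_def)
    then show ?thesis using set_pmf_step[OF assms(1,2) that]
      by (simp add: measure_pmf_single indicator_def)
  qed
  have "(\<Sum>v\<in>{1..n}. pmf (walk E (Suc t) v) x) =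
      (\<Sum>v\<in>{1..n}. \<Sum>u\<in>{1..n}. pmf (walk E t v) u * (indicator (E `` {x}) u / D))"
    using step by (intro sum.cong refl)
      (simp add: walk_Suc_sum[OF assms(1,2)] del: walk.simps flip: measure_pmf_single)
  also have "\<dots> = (\<Sum>u\<in>{1..n}. (\<Sum>v\<in>{1..n}. pmf (walk E t v) u) * (indicator (E `` {x}) u / D))"
    by (subst sum.swap) (simp only: sum_distrib_right)
  also have "\<dots> = (\<Sum>u\<in>{1..n}. indicator (E `` {x}) u / D)"
    using Suc.IH by (intro sum.cong) auto
  also have "\<dots> = real (card ({1..n} \<inter> E `` {x})) / D"
    using Indicator_Function.sum_mult_indicator[of "{1..n}" "\<lambda>_. 1 :: real" "E `` {x}"]
    by (simp add: sum_divide_distrib[symmetric])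
  also have "\<dots> = 1"
    using set_pmf_step[OF assms(1,2) Suc.prems] assms(2) by (simp add: Int_absorb1)
  finally show ?case .
qed

text \<open>This is stationarity of the uniform distribution without the factor
  \<open>1 / n\<close>: after exchanging sums, each pair of a time \<open>i\<close> and a vertex of
  \<open>S\<close> contributes a column sum 1.\<close>

lemma sum_visits:
  assumes "regular_graph n D E" "1 \<le> D" "S \<subseteq> {1..n}"
  shows "(\<Sum>v\<in>{1..n}. \<Sum>i<t. measure_pmf.prob (walk E i v) S) = real t * real (card S)"
proof -
  have fin: "finite S" using assms(3) finite_subset by blast
  have "(\<Sum>v\<in>{1..n}. \<Sum>i<t. measure_pmf.prob (walk E i v) S) =
      (\<Sum>i<t. \<Sum>v\<in>{1..n}. \<Sum>x\<in>S. pmf (walk E i v) x)"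
    using fin by (subst sum.swap) (simp add: measure_measure_pmf_finite)
  also have "\<dots> = (\<Sum>i<t. \<Sum>x\<in>S. \<Sum>v\<in>{1..n}. pmf (walk E i v) x)"
    by (intro sum.cong refl sum.swap)
  also have "\<dots> = (\<Sum>i<t. \<Sum>x\<in>S. 1)"
    using walk_doubly_stochastic[OF assms(1,2)] assms(3) by (intro sum.cong refl) blast
  finally show ?thesis by simp
qed

text \<open>The walk can only leave \<open>R \<union> S\<close> by a step from \<open>S\<close>. So
  between times \<open>t\<close> and \<open>t + 1\<close> the probability of being outside grows by
  at most the probability of being in \<open>S\<close> at time \<open>t\<close>.\<close>

lemma escape_le_visits:
  assumes "regular_graph n D E" "1 \<le> D" "v \<in> {1..n}" "v \<in> R \<union> S"
    and closed: "E `` R \<subseteq> R \<union> S"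
  shows "measure_pmf.prob (walk E t v) (- (R \<union> S)) \<le> (\<Sum>i<t. measure_pmf.prob (walk E i v) S)"
proof (induction t)
  case 0
  then show ?case using assms(4) by simp
next
  case (Suc t)
  let ?p = "pmf (walk E t v)"
  have "measure_pmf.prob (walk E (Suc t) v) (- (R \<union> S)) \<le>
     (\<Sum>u\<in>{1..n}. ?p u * (indicator (- (R \<union> S)) u + indicator S u))"
    unfolding walk_Suc_sum[OF assms(1-3)]
  proof (intro sum_mono mult_left_mono)
    fix u assume u: "u \<in> {1..n}"
    show "measure_pmf.prob (pmf_of_set (E `` {u})) (- (R \<union> S))
        \<le> indicator (- (R \<union> S)) u + (indicator S u :: real)"
    proof (cases "u \<in> R - S")
      case True
      then have "set_pmf (pmf_of_set (E `` {u})) \<inter> - (R \<union> S) = {}"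
        using closed set_pmf_step(1)[OF assms(1,2) u] by auto
      then have "measure_pmf.prob (pmf_of_set (E `` {u})) (- (R \<union> S)) = 0"
        by (simp add: measure_pmf_zero_iff)
      then show ?thesis by simp
    qed (auto simp: indicator_def)
  qed simp
  also have "\<dots> = measure_pmf.prob (walk E t v) (- (R \<union> S)) + measure_pmf.prob (walk E t v) S"
    unfolding prob_walk_sum[OF assms(1-3)]
    by (simp only: distrib_left sum.distrib)
  finally show ?case using Suc.IH by simp
qed

section \<open>Total variation distance and the cost of mixing across a separator\<close>

lemma tv_dist_ge:
  assumes "A \<subseteq> {1..n}"
  shows "\<bar>measure_pmf.prob P A - measure_pmf.prob Q A\<bar> \<le> tv_dist n P Q"
  unfolding tv_dist_def using assms by (intro Max_ge) auto

lemma prob_uniform: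
  fixes n :: nat
  assumes "1 \<le> n" "A \<subseteq> {1..n}"
  shows "measure_pmf.prob (pmf_of_set {1..n}) A = card A / n"
  using assms by (subst measure_pmf_of_set) (auto simp: Int_absorb1)

lemma walk_one_regular:
  assumes "regular_graph n 1 E" "v \<in> {1..n}"
  shows "\<exists>x\<in>{1..n}. walk E t v = return_pmf x"
proof (induction t)
  case 0
  then show ?case using assms by auto
next
  case (Suc t)
  then obtain x where x: "x \<in> {1..n}" "walk E t v = return_pmf x" by blast
  then obtain y where y: "E `` {x} = {y}"
    using assms(1) unfolding regular_graph_def by (meson card_1_singletonE)
  then have "y \<in> {1..n}" using set_pmf_step(4)[OF assms(1) _ x(1)] by auto
  then show ?case using x y by (auto simp: bind_return_pmf pmf_of_set_singleton)
qed

text \<open>The graph is a perfect matching, on which the walk is deterministic; a point mass has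
  distance at least \<open>1 - 1 / n\<close> from uniform, and \<open>n = 1\<close> would require a
  loop. This excludes \<open>D = 1\<close>, where there is no cycle.\<close>

lemma one_regular_not_mixing:
  assumes "regular_graph n 1 E" "v \<in> {1..n}"
  shows "tv_dist n (walk E t v) (pmf_of_set {1..n}) \<ge> 1/2"
proof -
  obtain x where x: "x \<in> {1..n}" "walk E t v = return_pmf x"
    using walk_one_regular[OF assms] by blast
  have "n \<noteq> 1"
  proof
    assume "n = 1"
    then have "E = {}" using assms(1) by (auto simp: regular_graph_def simple_graph_def irrefl_def)
    then show False using assms by (auto simp: regular_graph_def)
  qed
  then have n: "n \<ge> 2" using assms(2) by auto
  have "1/2 \<le> 1 - 1 / real n" using n by (simp add: field_simps)
  also have "\<dots> \<le> \<bar>measure_pmf.prob (walk E t v) {x} - measure_pmf.prob (pmf_of_set {1..n}) {x}\<bar>"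
    using prob_uniform[of n "{x}"] n x by simp
  also have "\<dots> \<le> tv_dist n (walk E t v) (pmf_of_set {1..n})"
    using x by (intro tv_dist_ge) auto
  finally show ?thesis .
qed

text \<open>Each well-mixed start accounts for at least \<open>1/3\<close> of the
  \<open>\<tau> * card S\<close> expected visits to \<open>S\<close>: a start in \<open>S\<close> is
  itself a visit at time 0, any other start must escape from its region \<open>R\<close>.\<close>

lemma mixing_imp_large_separator:
  assumes reg: "regular_graph n D E" and "1 \<le> D" "1 \<le> n" "0 < \<tau>"
    and S: "S \<subseteq> {1..n}" "100 * card S \<le> n"
    and sep: "\<And>v. v \<in> {1..n} - S \<Longrightarrow>
      \<exists>R. v \<in> R \<and> R \<subseteq> {1..n} \<and> 2 * card R \<le> n \<and> E `` R \<subseteq> R \<union> S"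
  shows "card {v \<in> {1..n}. tv_dist n (walk E \<tau> v) (pmf_of_set {1..n}) < 1 / 30}
    \<le> 3 * real \<tau> * real (card S)"
proof -
  let ?G = "{v \<in> {1..n}. tv_dist n (walk E \<tau> v) (pmf_of_set {1..n}) < 1 / 30}"
  let ?N = "\<lambda>v. \<Sum>i<\<tau>. measure_pmf.prob (walk E i v) S"
  have visits: "1/3 \<le> ?N v" if "v \<in> ?G" for v
  proof (cases "v \<in> S")
    case True
    have "1 \<le> measure_pmf.prob (walk E 0 v) S" using True by simp
    also have "\<dots> \<le> ?N v" using \<open>0 < \<tau>\<close> by (intro member_le_sum) auto
    finally show ?thesis by simp
  next
    case False
    then have "v \<in> {1..n} - S" using that by simp
    from sep[OF this]
    obtain R where R: "v \<in> R" "R \<subseteq> {1..n}" "2 * card R \<le> n" "E `` R \<subseteq> R \<union> S"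
      by (elim exE conjE)
    let ?A = "R \<union> S"
    have A: "?A \<subseteq> {1..n}" using R S by auto
    have "card ?A \<le> card R + card S" by (rule card_Un_le)
    \<comment> \<open>\<open>R\<close> fills at most half of the vertices and \<open>S\<close> one
      percent. Since \<open>51/100 + 1/30 < 2/3\<close>, a mixed walk is outside with probability at
      least \<open>1/3\<close>.\<close>
    then have "100 * card ?A \<le> 51 * n" using R(3) S(2) by linarith
    then have "real (card ?A) / n \<le> 51/100" using \<open>1 \<le> n\<close> by (simp add: field_simps)
    moreover have "\<bar>measure_pmf.prob (walk E \<tau> v) ?A - card ?A / n\<bar> < 1/30"
      using tv_dist_ge[OF A, of "walk E \<tau> v" "pmf_of_set {1..n}"] that
      unfolding prob_uniform[OF \<open>1 \<le> n\<close> A] by simp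
    ultimately have "measure_pmf.prob (walk E \<tau> v) ?A \<le> 2/3" by linarith
    then have "1/3 \<le> measure_pmf.prob (walk E \<tau> v) (- ?A)"
      using measure_pmf.prob_compl[of ?A "walk E \<tau> v"] by (simp add: Compl_eq_Diff_UNIV del: Compl_Un)
    also have "\<dots> \<le> ?N v"
      using R(1) that by (intro escape_le_visits[OF reg \<open>1 \<le> D\<close> _ _ R(4)]) simp_all
    finally show ?thesis .
  qed
  have "real (card ?G) / 3 = (\<Sum>v\<in>?G. 1/3)" by simp
  also have "\<dots> \<le> sum ?N ?G" using visits by (rule sum_mono)
  also have "\<dots> \<le> sum ?N {1..n}" by (intro sum_mono2) (auto intro: sum_nonneg)
  also have "\<dots> = real \<tau> * real (card S)" by (rule sum_visits[OF reg \<open>1 \<le> D\<close> S(1)])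
  finally show ?thesis by simp
qed

section \<open>Depth-first forests\<close>

lemma finite_has_maximal_image:
  fixes f :: "'a \<Rightarrow> 'b::linorder"
  assumes "finite A" "A \<noteq> {}"
  shows "\<exists>x\<in>A. \<forall>y\<in>A. f y \<le> f x"
proof -
  have "Max (f ` A) \<in> f ` A" using assms by simp
  then obtain x where "x \<in> A" "f x = Max (f ` A)" by auto
  then show ?thesis using assms by (intro bexI[of _ x]) auto
qed

text \<open>
  Vertex \<open>0\<close> serves as a virtual root, and depth \<open>0\<close> marks a vertex of \<open>{1..n}\<close> that
  does not belong to the forest (yet).
\<close>

locale parent_forest =
  fixes n :: nat and E :: "(nat \<times> nat) set" and par dep :: "nat \<Rightarrow> nat"
  assumes dep_0: "dep 0 = 0"
    and par_le: "v \<le> n \<Longrightarrow> par v \<le> n"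
    and dep_par: "v \<le> n \<Longrightarrow> 0 < dep v \<Longrightarrow> dep v = Suc (dep (par v))"
    and par_edge: "v \<le> n \<Longrightarrow> 0 < dep v \<Longrightarrow> par v \<noteq> 0 \<Longrightarrow> 0 < dep (par v) \<and> (v, par v) \<in> E"
begin

definition vis :: "nat \<Rightarrow> bool" where
  "vis v \<longleftrightarrow> v \<le> n \<and> (v = 0 \<or> 0 < dep v)"

text \<open>Depth drops by exactly one along \<open>par\<close>, so the number of parent steps from
  \<open>v\<close> to an ancestor \<open>u\<close> is forced; ancestry becomes an equation without a
  quantifier.\<close>

definition anc :: "nat \<Rightarrow> nat \<Rightarrow> bool" where
  "anc u v \<longleftrightarrow> dep u \<le> dep v \<and> (par ^^ (dep v - dep u)) v = u"

lemma par_pow_vis: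
  assumes "vis v" "k \<le> dep v"
  shows "vis ((par ^^ k) v) \<and> dep ((par ^^ k) v) = dep v - k"
  using assms(2)
proof (induction k)
  case 0
  then show ?case using assms(1) by simp
next
  case (Suc k)
  let ?x = "(par ^^ k) v"
  have x: "vis ?x" "dep ?x = dep v - k" using Suc by auto
  then have "0 < dep ?x" using Suc.prems by simp
  moreover have "?x \<le> n" using x by (simp add: vis_def)
  ultimately have "vis (par ?x)" "dep ?x = Suc (dep (par ?x))"
    using par_le[of ?x] dep_par[of ?x] par_edge[of ?x] unfolding vis_def by linarith+
  then show ?case using x by simp
qed

lemma anc_refl [simp]: "anc v v"
  by (simp add: anc_def)

lemma anc_dep_le: "anc u v \<Longrightarrow> dep u \<le> dep v"
  by (simp add: anc_def)

lemma anc_par_pow: "anc u v \<Longrightarrow> (par ^^ (dep v - dep u)) v = u"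
  by (simp add: anc_def)

lemma anc_trans:
  assumes "anc u v" "anc v x" shows "anc u x"
proof -
  have "dep x - dep u = (dep v - dep u) + (dep x - dep v)"
    using assms anc_dep_le by fastforce
  then have "(par ^^ (dep x - dep u)) x = (par ^^ (dep v - dep u)) ((par ^^ (dep x - dep v)) x)"
    by (simp only: funpow_add o_apply)
  then show ?thesis using assms unfolding anc_def by (metis le_trans)
qed

text \<open>The ancestors of \<open>x\<close> form a chain ordered by depth: the longer climb from
  \<open>x\<close> to \<open>u\<close> factors through \<open>v\<close>.\<close>

lemma anc_linear:
  assumes "anc u x" "anc v x" "dep u \<le> dep v" shows "anc u v"
proof -
  have "dep x - dep u = (dep v - dep u) + (dep x - dep v)"
    using assms anc_dep_le by fastforce
  then have "(par ^^ (dep x - dep u)) x = (par ^^ (dep v - dep u)) ((par ^^ (dep x - dep v)) x)"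
    by (simp only: funpow_add o_apply)
  then show ?thesis using assms unfolding anc_def by (metis le_trans)
qed

lemma anc_dep_eq:
  assumes "anc u v" "dep u = dep v" shows "u = v"
  using assms(1) unfolding anc_def assms(2) by simp

lemma anc_pow:
  assumes "vis v" "k \<le> dep v" shows "anc ((par ^^ k) v) v"
  using par_pow_vis[OF assms] assms(2) by (simp add: anc_def)

text \<open>Climbing \<open>dep v\<close> steps ends at a visited vertex of depth 0, and only the
  virtual root is one.\<close>

lemma anc_0:
  assumes "vis v" shows "anc 0 v"
proof -
  have "(par ^^ dep v) v = 0" using par_pow_vis[OF assms, of "dep v"] by (auto simp: vis_def)
  then show ?thesis by (simp add: anc_def dep_0)
qed

lemma anc_par_iff:
  assumes "vis v" "v \<noteq> 0" shows "anc u v \<longleftrightarrow> u = v \<or> anc u (par v)"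
proof -
  have d: "dep v = Suc (dep (par v))" using assms dep_par by (auto simp: vis_def)
  have "anc (par v) v" using anc_pow[OF assms(1), of 1] d by simp
  moreover have "anc u (par v)" if "anc u v" "u \<noteq> v"
  proof (rule anc_linear[OF that(1) \<open>anc (par v) v\<close>])
    show "dep u \<le> dep (par v)" using that d anc_dep_eq[of u v] anc_dep_le[of u v] by linarith
  qed
  ultimately show ?thesis using anc_trans anc_refl by blast
qed

text \<open>The root path of \<open>v\<close> meets every depth from 1 to \<open>dep v\<close> at a
  vertex of \<open>{1..n}\<close>. This later bounds the length of the output.\<close>

lemma dep_le:
  assumes "vis v" shows "dep v \<le> n"
proof -
  have "{1..dep v} \<subseteq> dep ` {1..n}"
  proof
    fix d assume d: "d \<in> {1..dep v}"
    let ?x = "(par ^^ (dep v - d)) v"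
    have "vis ?x" "dep ?x = d" using par_pow_vis[OF assms, of "dep v - d"] d by auto
    moreover from this have "?x \<noteq> 0" using d dep_0 by (metis atLeastAtMost_iff not_one_le_zero)
    ultimately show "d \<in> dep ` {1..n}" by (auto simp: vis_def intro!: image_eqI[of _ _ ?x])
  qed
  then have "card {1..dep v} \<le> card (dep ` {1..n})" by (intro card_mono) auto
  also have "\<dots> \<le> card {1..n}" by (rule card_image_le) simp
  finally show ?thesis by simp
qed

text \<open>The tree path from \<open>v\<close> up to \<open>u\<close> is closed by the edge between
  them. Depths tell its vertices apart, \<open>0 < dep u\<close> keeps the virtual root off the
  path, and \<open>2 \<le> b\<close> provides three vertices.\<close>

lemma is_cycle_par_path:
  assumes "sym E" "vis v" "0 < dep u" "anc u v" "(v, u) \<in> E" "dep v - dep u = b" "2 \<le> b"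
  shows "is_cycle E (map (\<lambda>k. (par ^^ k) v) [0..<Suc b])"
proof -
  have u: "(par ^^ b) v = u" using anc_par_pow[OF assms(4)] assms(6) by simp
  have k: "vis ((par ^^ k) v) \<and> dep ((par ^^ k) v) = dep v - k" if "k \<le> b" for k
    using par_pow_vis assms that by simp
  have b: "b < dep v" using assms by auto
  have inj: "inj_on (\<lambda>k. (par ^^ k) v) {0..<Suc b}"
  proof (rule inj_onI)
    fix i j assume "i \<in> {0..<Suc b}" "j \<in> {0..<Suc b}" and eq: "(par ^^ i) v = (par ^^ j) v"
    then have "i \<le> b" "j \<le> b" by auto
    then have "dep v - i = dep v - j" using k[of i] k[of j] eq by metis
    then show "i = j" using \<open>i \<le> b\<close> \<open>j \<le> b\<close> b by linarith
  qed
  have edge: "((par ^^ i) v, (par ^^ (Suc i mod Suc b)) v) \<in> E" if "i < Suc b" for i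
  proof (cases "i = b")
    case True
    then show ?thesis using u assms by (simp add: sym_def)
  next
    case False
    then have i: "Suc i \<le> b" using that by simp
    have "dep (par ((par ^^ i) v)) = dep v - Suc i" using k[OF i] by simp
    then have "par ((par ^^ i) v) \<noteq> 0" using i b dep_0 by (metis le_less_trans zero_less_diff less_irrefl)
    then have "((par ^^ i) v, par ((par ^^ i) v)) \<in> E"
      using par_edge[of "(par ^^ i) v"] k[of i] i b unfolding vis_def by auto
    then show ?thesis using i by simp
  qed
  show ?thesis unfolding is_cycle_def
    using inj edge \<open>2 \<le> b\<close> by (auto simp: distinct_map nth_append simp del: upt_Suc)
qed

end

text \<open>The outcome of a completed search. The subtraction in \<open>span_le\<close> is
  truncated, but as \<open>E\<close> is symmetric the bound covers both directions of an
  edge.\<close>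

locale dfs_forest = parent_forest +
  fixes b :: nat
  assumes graph: "simple_graph n E"
    and all_vis: "v \<in> {1..n} \<Longrightarrow> 0 < dep v"
    and comparable: "(u, v) \<in> E \<Longrightarrow> anc u v \<or> anc v u"
    and span_le: "(u, v) \<in> E \<Longrightarrow> dep u - dep v \<le> b"
begin

lemma vis_all: "v \<le> n \<Longrightarrow> vis v"
  using all_vis[of v] by (cases "v = 0") (auto simp: vis_def)

lemma edge_in: "(u, v) \<in> E \<Longrightarrow> u \<in> {1..n} \<and> v \<in> {1..n}"
  using graph by (auto simp: simple_graph_def)

lemma edge_sym: "(u, v) \<in> E \<Longrightarrow> (v, u) \<in> E"
  using graph by (auto simp: simple_graph_def sym_def)

text \<open>All neighbours of a deepest vertex are proper ancestors of it. With two neighbours, one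
  differs from the parent and lies at least two levels higher.\<close>

lemma two_le_span:
  assumes "regular_graph n D E" "2 \<le> D" "1 \<le> n"
  shows "2 \<le> b"
proof -
  obtain v where "v \<in> {1..n}" and v: "\<forall>u\<in>{1..n}. dep u \<le> dep v"
    using finite_has_maximal_image[of "{1..n}" dep] \<open>1 \<le> n\<close> by auto
  have "\<not> (E `` {v} \<subseteq> {par v})"
  proof
    assume "E `` {v} \<subseteq> {par v}"
    then have "card (E `` {v}) \<le> 1" using card_mono[of "{par v}"] by fastforce
    then show False using assms \<open>v \<in> {1..n}\<close> by (auto simp: regular_graph_def)
  qed
  then obtain u where u: "(v, u) \<in> E" "u \<noteq> par v" by auto
  have "u \<noteq> v" using u graph by (auto simp: simple_graph_def irrefl_def)
  have le: "dep u \<le> dep v" using v edge_in u by blast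
  then have "anc u v" using comparable[OF u(1)] anc_dep_eq[of v u] anc_dep_le[of v u] by auto
  moreover have "dep v - dep u \<noteq> 0" using le \<open>u \<noteq> v\<close> anc_dep_eq[OF \<open>anc u v\<close>] by auto
  moreover have "dep v - dep u \<noteq> 1" 
  proof
    assume "dep v - dep u = 1"
    then show False using anc_par_pow[OF \<open>anc u v\<close>] u(2) by simp
  qed
  ultimately show ?thesis using span_le[OF u(1)] by linarith
qed

section \<open>Balanced separators from depth-first forests\<close>

definition subtree :: "nat \<Rightarrow> nat set" where
  "subtree c = {x \<in> {1..n}. anc c x}"

definition upper_path :: "nat \<Rightarrow> nat set" where
  "upper_path c = {x \<in> {1..n}. anc x c \<and> dep c - dep x < b}"

lemma card_upper_path: "card (upper_path c) \<le> b"
proof -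
  have "upper_path c \<subseteq> (\<lambda>k. (par ^^ k) c) ` {..<b}"
  proof
    fix x assume x: "x \<in> upper_path c"
    then have "x = (par ^^ (dep c - dep x)) c" by (simp add: upper_path_def anc_par_pow)
    then show "x \<in> (\<lambda>k. (par ^^ k) c) ` {..<b}"
      using x unfolding upper_path_def by blast
  qed
  then have "card (upper_path c) \<le> card ((\<lambda>k. (par ^^ k) c) ` {..<b})" by (intro card_mono) auto
  also have "\<dots> \<le> b" using card_image_le[of "{..<b}"] by fastforce
  finally show ?thesis .
qed

text \<open>An edge leaving the subtree of the child \<open>c'\<close> ends at an ancestor of
  \<open>c\<close> or at \<open>c\<close>. It starts at least one level below \<open>c\<close> and
  spans at most \<open>b\<close> levels, so it ends fewer than \<open>b\<close> levels above
  \<open>c\<close>.\<close>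

lemma subtree_closed:
  assumes c: "dep c' = Suc (dep c)" "anc c c'"
  shows "E `` subtree c' \<subseteq> subtree c' \<union> upper_path c"
proof
  fix y assume "y \<in> E `` subtree c'"
  then obtain x where x: "(x, y) \<in> E" "anc c' x" by (auto simp: subtree_def)
  have y: "y \<in> {1..n}" using x edge_in by blast
  show "y \<in> subtree c' \<union> upper_path c"
  proof (cases "anc c' y")
    case True
    then show ?thesis using y by (simp add: subtree_def)
  next
    case False
    then have "anc y x" using comparable[OF x(1)] anc_trans x(2) by blast
    then have "dep y < dep c'" using False anc_linear[OF x(2)] by (meson not_le)
    moreover have "anc c x" using c(2) x(2) anc_trans by blast
    ultimately have "anc y c" using c(1) anc_linear[OF \<open>anc y x\<close>] by simp
    moreover have "dep c' \<le> dep x" using x(2) by (rule anc_dep_le)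
    ultimately show ?thesis using y span_le[OF x(1)] c(1) \<open>dep y < dep c'\<close>
      by (auto simp: upper_path_def)
  qed
qed

text \<open>An edge into the subtree of \<open>c\<close> from outside starts at a proper ancestor of
  \<open>c\<close>. Off \<open>upper_path c\<close> this is at least \<open>b\<close> levels above
  \<open>c\<close>, so the edge can only reach \<open>c\<close> itself, which belongs to the
  separator because \<open>0 < b\<close>.\<close>

lemma outside_closed:
  assumes "0 < b"
  shows "E `` ({1..n} - subtree c - upper_path c) \<subseteq> ({1..n} - subtree c - upper_path c) \<union> upper_path c"
proof
  fix y assume "y \<in> E `` ({1..n} - subtree c - upper_path c)"
  then obtain x where x: "(x, y) \<in> E" "x \<in> {1..n}" "\<not> anc c x" "x \<notin> upper_path c"
    unfolding subtree_def by blast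
  have y: "y \<in> {1..n}" using x edge_in by blast
  show "y \<in> ({1..n} - subtree c - upper_path c) \<union> upper_path c"
  proof (cases "anc c y")
    case True
    then have "anc x y" using comparable[OF x(1)] anc_trans x(3) by blast
    then have "dep x < dep c" using x(3) anc_linear[OF True] by (meson not_le)
    then have "anc x c" using anc_linear[OF \<open>anc x y\<close> True] by simp
    then have "b \<le> dep c - dep x" using x by (auto simp: upper_path_def)
    moreover have "dep c \<le> dep y" using True by (rule anc_dep_le)
    ultimately have "dep c = dep y" using span_le[OF edge_sym[OF x(1)]] \<open>dep x < dep c\<close> by linarith
    then have "y = c" using True anc_dep_eq by blast
    then show ?thesis using y assms by (simp add: upper_path_def)
  qed (use y in \<open>auto simp: subtree_def\<close>)
qed

text \<open>The separator sits above a centroid of the forest: a deepest vertex (possibly the virtual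
  root) whose subtree contains at least half of the vertices.\<close>

lemma balanced_separator:
  assumes "0 < b"
  obtains S where "S \<subseteq> {1..n}" "card S \<le> b"
    "\<And>v. v \<in> {1..n} - S \<Longrightarrow>
      \<exists>R. v \<in> R \<and> R \<subseteq> {1..n} \<and> 2 * card R \<le> n \<and> E `` R \<subseteq> R \<union> S"
proof -
  let ?P = "\<lambda>c. c \<le> n \<and> n \<le> 2 * card (subtree c)"
  have "subtree 0 = {1..n}" using anc_0 vis_all by (auto simp: subtree_def)
  then have "?P 0" by simp
  have "finite {c. ?P c}" by simp
  moreover have "{c. ?P c} \<noteq> {}" using \<open>?P 0\<close> by blast
  ultimately have "\<exists>c\<in>{c. ?P c}. \<forall>x\<in>{c. ?P c}. dep x \<le> dep c"
    by (rule finite_has_maximal_image)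
  then obtain c where "c \<in> {c. ?P c}" and max: "\<forall>x\<in>{c. ?P c}. dep x \<le> dep c" by (elim bexE)
  then have c: "c \<le> n" "n \<le> 2 * card (subtree c)" by auto
  let ?S = "upper_path c"
  have sep: "\<exists>R. v \<in> R \<and> R \<subseteq> {1..n} \<and> 2 * card R \<le> n \<and> E `` R \<subseteq> R \<union> ?S"
    if v: "v \<in> {1..n} - ?S" for v
  proof (cases "anc c v")
    case False
    let ?R = "{1..n} - subtree c - ?S"
    \<comment> \<open>The subtree of \<open>c\<close> holds at least half of the vertices, so at
      most half remain outside.\<close>
    have "card ?R \<le> card ({1..n} - subtree c)" by (intro card_mono) auto
    also have "\<dots> = n - card (subtree c)" by (subst card_Diff_subset) (auto simp: subtree_def)
    finally have "2 * card ?R \<le> n" using c by linarith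
    moreover have "v \<in> ?R" using v False by (simp add: subtree_def)
    moreover have "?R \<subseteq> {1..n}" by blast
    ultimately show ?thesis using outside_closed[OF assms, of c] by (intro exI[of _ ?R] conjI)
  next
    case True
    have "c \<noteq> v" using v assms by (auto simp: upper_path_def)
    then have less: "dep c < dep v" using anc_dep_le[OF True] anc_dep_eq[OF True] by linarith
    \<comment> \<open>The child of \<open>c\<close> on the path down to \<open>v\<close>; being
      deeper than \<open>c\<close>, it has a subtree with fewer than half of the vertices.\<close>
    define c' where "c' = (par ^^ (dep v - Suc (dep c))) v"
    have "vis c'" and d: "dep c' = Suc (dep c)"
      using par_pow_vis[OF vis_all, of v "dep v - Suc (dep c)"] v less by (auto simp: c'_def)
    have "anc c' v" unfolding c'_def using v by (intro anc_pow vis_all) auto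
    then have "anc c c'" using anc_linear[OF True] d by simp
    have "\<not> ?P c'" using max d by auto
    then have "2 * card (subtree c') \<le> n" using \<open>vis c'\<close> by (auto simp: vis_def)
    moreover have "v \<in> subtree c'" using v \<open>anc c' v\<close> by (simp add: subtree_def)
    moreover have "subtree c' \<subseteq> {1..n}" by (auto simp: subtree_def)
    ultimately show ?thesis using subtree_closed[OF d \<open>anc c c'\<close>]
      by (intro exI[of _ "subtree c'"] conjI)
  qed
  have "?S \<subseteq> {1..n}" by (auto simp: upper_path_def)
  then show ?thesis by (rule that[OF _ card_upper_path sep])
qed

lemma long_span:
  assumes "0 < \<epsilon>" "\<epsilon> < 2/5" "0 < \<tau>" "1 \<le> D" "1 \<le> n" "regular_graph n D E"
    and mix: "real (card {v \<in> {1..n}. tv_dist n (walk E \<tau> v) (pmf_of_set {1..n}) < 1 / 30})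
          \<ge> \<epsilon> * real n"
  shows "2 \<le> b" "real (Suc b) > \<epsilon> * real n / (40 * real \<tau>)"
proof -
  let ?G = "{v \<in> {1..n}. tv_dist n (walk E \<tau> v) (pmf_of_set {1..n}) < 1 / 30}"
  have pos: "0 < \<epsilon> * real n" using assms by simp
  have "?G \<noteq> {}" using mix pos by (metis card.empty of_nat_0 not_le)
  then obtain v where v: "v \<in> {1..n}" "tv_dist n (walk E \<tau> v) (pmf_of_set {1..n}) < 1 / 30"
    by blast
  have "D \<noteq> 1"
  proof
    assume "D = 1"
    then show False using one_regular_not_mixing[of n E v \<tau>] assms(6) v by simp
  qed
  then show "2 \<le> b" using two_le_span assms by simp
  show "real (Suc b) > \<epsilon> * real n / (40 * real \<tau>)"
  proof (rule ccontr)
    assume "\<not> ?thesis"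
    then have "real (Suc b) * (40 * real \<tau>) \<le> \<epsilon> * real n"
      using \<open>0 < \<tau>\<close> by (simp add: field_simps)
    then have *: "40 * (real \<tau> * real b) \<le> \<epsilon> * real n"
      using \<open>0 < \<tau>\<close> by (simp add: algebra_simps)
    have "0 < b" using \<open>2 \<le> b\<close> by simp
    then obtain S where S: "S \<subseteq> {1..n}" "card S \<le> b"
      "\<And>v. v \<in> {1..n} - S \<Longrightarrow>
        \<exists>R. v \<in> R \<and> R \<subseteq> {1..n} \<and> 2 * card R \<le> n \<and> E `` R \<subseteq> R \<union> S"
      by (rule balanced_separator) blast
    \<comment> \<open>With \<open>\<tau> \<ge> 1\<close> and \<open>\<epsilon> < 2/5\<close>, the
      assumed bound yields \<open>40 * b \<le> 2/5 * n\<close>, which is the one percent allowed for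
      the separator.\<close>
    have "real b \<le> real \<tau> * real b" using \<open>0 < \<tau>\<close> mult_right_mono[of 1 "real \<tau>" "real b"] by simp
    moreover have "\<epsilon> * real n \<le> 2/5 * real n" using assms by (intro mult_right_mono) auto
    ultimately have "100 * real b \<le> real n" using * by linarith
    then have "100 * card S \<le> n" using S(2) by linarith
    then have "real (card ?G) \<le> 3 * real \<tau> * real (card S)"
      by (rule mixing_imp_large_separator[OF assms(6,4,5,3) S(1) _ S(3)])
    also have "\<dots> \<le> 3 * real \<tau> * real b" using S(2) by (intro mult_left_mono) auto
    \<comment> \<open>Now \<open>\<epsilon> * n \<le> 3 * \<tau> * b\<close>, while
      \<open>40 * \<tau> * b \<le> \<epsilon> * n\<close> and \<open>\<epsilon> * n\<close> is
      positive.\<close>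
    finally show False using * mix pos by simp
  qed
qed

end

section \<open>Invariant of the depth-first search\<close>

text \<open>
  The search stands at \<open>cur\<close>, whose ancestors form the stack, and has examined the possible neighbours
  below \<open>w\<close>. Visited vertices off the stack are finished. \<open>b\<close> is the largest span of an
  edge seen so far, attained at an edge going up from \<open>v\<^sub>b\<close>.
\<close>

locale dfs_state = parent_forest +
  fixes cur w b v\<^sub>b :: nat
  assumes graph: "simple_graph n E"
    and vis_cur: "vis cur"
    and w_ge: "1 \<le> w" and w_le: "w \<le> Suc n"
    and finished: "v \<le> n \<Longrightarrow> 0 < dep v \<Longrightarrow> \<not> anc v cur \<Longrightarrow> (v, u) \<in> E \<Longrightarrow>
      0 < dep u \<and> (anc u v \<or> anc v u) \<and> dep v - dep u \<le> b"
    and scanned: "1 \<le> u \<Longrightarrow> u < w \<Longrightarrow> cur = 0 \<or> (cur, u) \<in> E \<Longrightarrow> 0 < dep u \<and> dep cur - dep u \<le> b"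
    and witness: "0 < b \<Longrightarrow> vis v\<^sub>b \<and> (\<exists>u. (v\<^sub>b, u) \<in> E \<and> 0 < dep u \<and> anc u v\<^sub>b \<and> dep v\<^sub>b - dep u = b)"
    and v\<^sub>b_le: "v\<^sub>b \<le> n"
begin

lemma edge_in: "(u, v) \<in> E \<Longrightarrow> u \<in> {1..n} \<and> v \<in> {1..n}"
  using graph by (auto simp: simple_graph_def)

lemma edge_sym: "(u, v) \<in> E \<Longrightarrow> (v, u) \<in> E"
  using graph by (auto simp: simple_graph_def sym_def)

text \<open>If \<open>u\<close> is off the stack, it is finished, and the edge was already accounted
  for from its side.\<close>

lemma visited_neighbour_comparable:
  assumes "(cur, u) \<in> E" "0 < dep u"
  shows "anc u cur \<or> anc cur u"
proof (cases "anc u cur")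
  case False
  have "u \<le> n" using edge_in assms by auto
  then show ?thesis using finished[OF _ assms(2) False edge_sym[OF assms(1)]] by blast
qed simp

text \<open>Only the candidate \<open>w\<close> is new. The virtual root counts as adjacent to every
  vertex, so that its scan starts a tree in each component.\<close>

lemma advance:
  assumes "w \<le> n" "cur = 0 \<or> (cur, w) \<in> E \<Longrightarrow> 0 < dep w \<and> dep cur - dep w \<le> b"
  shows "dfs_state n E par dep cur (Suc w) b v\<^sub>b"
proof (unfold_locales)
  fix u assume u: "1 \<le> u" "u < Suc w" "cur = 0 \<or> (cur, u) \<in> E"
  show "0 < dep u \<and> dep cur - dep u \<le> b"
  proof (cases "u = w")
    case True
    then show ?thesis using assms u by simp
  next
    case False
    then show ?thesis using scanned u by simp
  qed
qed (fact graph vis_cur finished witness v\<^sub>b_le | use assms in simp)+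

text \<open>A positive span puts \<open>w\<close> strictly above \<open>cur\<close>; comparability
  then makes it an ancestor, hence a valid witness.\<close>

lemma record_span:
  assumes "(cur, w) \<in> E" "0 < dep w" "b < dep cur - dep w"
  shows "dfs_state n E par dep cur w (dep cur - dep w) cur"
proof (unfold_locales)
  let ?b = "dep cur - dep w"
  show "0 < dep u \<and> (anc u v \<or> anc v u) \<and> dep v - dep u \<le> ?b"
    if "v \<le> n" "0 < dep v" "\<not> anc v cur" "(v, u) \<in> E" for u v
    using finished[OF that] assms(3) by simp
  show "0 < dep u \<and> dep cur - dep u \<le> ?b" if "1 \<le> u" "u < w" "cur = 0 \<or> (cur, u) \<in> E" for u
    using scanned[OF that] assms(3) by simp
  have "anc w cur"
    using visited_neighbour_comparable[OF assms(1,2)] anc_dep_le[of cur w] assms(3) by auto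
  then show "vis cur \<and> (\<exists>u. (cur, u) \<in> E \<and> 0 < dep u \<and> anc u cur \<and> dep cur - dep u = ?b)"
    using assms vis_cur by blast
  show "cur \<le> n" using vis_cur by (simp add: vis_def)
qed (fact graph vis_cur w_ge w_le)+

text \<open>All candidates have been scanned, so \<open>cur\<close> becomes finished. The scan at
  its parent restarts from 1, so no record of the old position is kept.\<close>

lemma pop:
  assumes "w = Suc n" "cur \<noteq> 0"
  shows "dfs_state n E par dep (par cur) 1 b v\<^sub>b" "dep cur = Suc (dep (par cur))"
proof -
  have cur: "cur \<le> n" "0 < dep cur" using vis_cur assms by (auto simp: vis_def)
  show d: "dep cur = Suc (dep (par cur))" using dep_par cur by simp
  show "dfs_state n E par dep (par cur) 1 b v\<^sub>b"
  proof (unfold_locales)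
    show "vis (par cur)" using par_pow_vis[OF vis_cur, of 1] cur by simp
    fix u v assume v: "v \<le> n" "0 < dep v" "\<not> anc v (par cur)" "(v, u) \<in> E"
    show "0 < dep u \<and> (anc u v \<or> anc v u) \<and> dep v - dep u \<le> b"
    proof (cases "v = cur")
      case True
      have "1 \<le> u" "u < w" using edge_in[OF v(4)] assms(1) by auto
      then have "0 < dep u \<and> dep cur - dep u \<le> b" using scanned v(4) True by blast
      then show ?thesis using visited_neighbour_comparable v(4) True by blast
    next
      case False
      then have "\<not> anc v cur" using anc_par_iff[OF vis_cur assms(2)] v(3) by blast
      then show ?thesis using finished v by blast
    qed
  qed (fact graph witness v\<^sub>b_le | simp)+
qed

text \<open>An unvisited \<open>w\<close> lies on no root path of a visited vertex, so attaching it
  below \<open>cur\<close> preserves ancestry among the old vertices and extends the stack by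
  \<open>w\<close>.\<close>

lemma push:
  assumes w: "w \<le> n" "dep w = 0" and edge: "cur = 0 \<or> (cur, w) \<in> E"
  shows "dfs_state n E (par(w := cur)) (dep(w := Suc (dep cur))) w 1 b v\<^sub>b"
proof -
  let ?par = "par(w := cur)" and ?dep = "dep(w := Suc (dep cur))"
  have w0: "w \<noteq> 0" using w_ge by simp
  have cur: "cur \<le> n" "cur = 0 \<or> 0 < dep cur" using vis_cur by (auto simp: vis_def)
  have par_w: "par v \<noteq> w" if "v \<le> n" "0 < dep v" for v
    using par_edge[OF that] w(2) w0 by auto
  have cur_w: "cur \<noteq> w" using cur w w0 by auto
  interpret new: parent_forest n E ?par ?dep
  proof
    show "?dep 0 = 0" using w0 dep_0 by simp
    show "?par v \<le> n" if "v \<le> n" for v using that par_le cur by simp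
    show "?dep v = Suc (?dep (?par v))" if "v \<le> n" "0 < ?dep v" for v
    proof (cases "v = w")
      case False
      then show ?thesis using that dep_par[of v] par_w[of v] by simp
    qed (use cur_w in simp)
    show "0 < ?dep (?par v) \<and> (v, ?par v) \<in> E" if "v \<le> n" "0 < ?dep v" "?par v \<noteq> 0" for v
    proof (cases "v = w")
      case True
      then show ?thesis using that cur cur_w edge edge_sym by simp
    next
      case False
      then show ?thesis using that par_edge[of v] by simp
    qed
  qed
  have vis_w: "new.vis v" if "vis v" for v
    using that by (auto simp: vis_def new.vis_def)
  have pow: "(?par ^^ k) v = (par ^^ k) v" if "vis v" "k \<le> dep v" for v k
    using that(2)
  proof (induction k)
    case (Suc k)
    have "vis ((par ^^ k) v)" "dep ((par ^^ k) v) = dep v - k"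
      using par_pow_vis[OF that(1)] Suc.prems by auto
    then have "(par ^^ k) v \<noteq> w" using w Suc.prems by auto
    then show ?case using Suc by simp
  qed simp
  have anc_iff: "new.anc u v \<longleftrightarrow> anc u v" if "vis u" "vis v" for u v
  proof -
    have "u \<noteq> w" "v \<noteq> w" using that w w0 by (auto simp: vis_def)
    then show ?thesis unfolding new.anc_def anc_def using pow[OF that(2), of "dep v - dep u"] by simp
  qed
  have vis_new: "new.vis w" using w by (simp add: new.vis_def)
  have anc_w: "new.anc u w \<longleftrightarrow> u = w \<or> new.anc u cur" for u
    using new.anc_par_iff[OF vis_new w0] by simp
  show ?thesis
  proof (unfold_locales)
    fix u v assume v: "v \<le> n" "0 < ?dep v" "\<not> new.anc v w" "(v, u) \<in> E"
    then have "v \<noteq> w" using anc_w by blast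
    then have v': "vis v" "0 < dep v" using v by (auto simp: vis_def)
    \<comment> \<open>The new stack contains the old one, so a vertex off the new stack was finished
      before.\<close>
    then have "\<not> anc v cur" using v(3) anc_w anc_iff vis_cur by blast
    then have *: "0 < dep u \<and> (anc u v \<or> anc v u) \<and> dep v - dep u \<le> b"
      using finished v v' by blast
    then have "vis u" "u \<noteq> w" using edge_in[OF v(4)] w by (auto simp: vis_def)
    then show "0 < ?dep u \<and> (new.anc u v \<or> new.anc v u) \<and> ?dep v - ?dep u \<le> b"
      using * anc_iff v' \<open>v \<noteq> w\<close> by simp
  next
    assume "0 < b"
    from witness[OF this] obtain u where
      u: "vis v\<^sub>b" "(v\<^sub>b, u) \<in> E" "0 < dep u" "anc u v\<^sub>b" "dep v\<^sub>b - dep u = b" by blast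
    have "vis u" using u edge_in[OF u(2)] by (auto simp: vis_def)
    moreover have "u \<noteq> w" "v\<^sub>b \<noteq> w" using u w w0 by (auto simp: vis_def)
    ultimately show "new.vis v\<^sub>b \<and>
        (\<exists>u. (v\<^sub>b, u) \<in> E \<and> 0 < ?dep u \<and> new.anc u v\<^sub>b \<and> ?dep v\<^sub>b - ?dep u = b)"
      using u anc_iff vis_w by (intro conjI exI[of _ u]) auto
  qed (fact graph vis_new v\<^sub>b_le | simp)+
qed

text \<open>Only the virtual root is left on the stack and its scan is complete, so every vertex is
  visited and finished.\<close>

lemma dfs_forest_final:
  assumes "w = Suc n" "cur = 0"
  shows "dfs_forest n E par dep b"
proof (unfold_locales)
  show all: "0 < dep v" if "v \<in> {1..n}" for v
    using scanned[of v] that assms by auto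
  have *: "0 < dep v \<and> (anc v u \<or> anc u v) \<and> dep u - dep v \<le> b" if "(u, v) \<in> E" for u v
  proof (rule finished)
    have u: "u \<in> {1..n}" using edge_in[OF that] by blast
    then show "u \<le> n" "0 < dep u" using all by auto
    then show "\<not> anc u cur" using anc_dep_le[of u 0] assms(2) dep_0 by auto
  qed (fact that)
  show "anc u v \<or> anc v u" "dep u - dep v \<le> b" if "(u, v) \<in> E" for u v
    using *[OF that] by auto
qed (fact graph)

end

lemma dfs_state_initial:
  assumes "simple_graph n E"
  shows "dfs_state n E (\<lambda>_. 0) (\<lambda>_. 0) 0 1 0 0"
proof -
  interpret parent_forest n E "\<lambda>_. 0" "\<lambda>_. 0" by unfold_locales auto
  show ?thesis by unfold_locales (use assms in \<open>auto simp: vis_def\<close>)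
qed

section \<open>Reasoning about programs\<close>

primrec loop_free :: "com \<Rightarrow> bool" where
  "loop_free CSkip = True"
| "loop_free (CSet r a) = True"
| "loop_free (CStore a a') = True"
| "loop_free (CSeq c d) = (loop_free c \<and> loop_free d)"
| "loop_free (CIf e c d) = (loop_free c \<and> loop_free d)"
| "loop_free (CWhile e c) = False"

text \<open>Execution as a function, for loop-free programs; the value at \<open>CWhile\<close> is a
  dummy.\<close>

primrec run :: "com \<Rightarrow> state \<Rightarrow> state" where
  "run CSkip s = s"
| "run (CSet r a) s = ((fst s)(r := aval a s), snd s)"
| "run (CStore a a') s = (fst s, (snd s)(aval a s := aval a' s))"
| "run (CSeq c d) s = run d (run c s)"
| "run (CIf e c d) s = (if bval e s then run c s else run d s)"
| "run (CWhile e c) s = s"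

text \<open>Adding the costs of both branches gives a bound independent of the state.\<close>

primrec max_cost :: "com \<Rightarrow> nat" where
  "max_cost CSkip = 1"
| "max_cost (CSet r a) = acost a + 1"
| "max_cost (CStore a a') = acost a + acost a' + 1"
| "max_cost (CSeq c d) = max_cost c + max_cost d"
| "max_cost (CIf e c d) = bcost e + max_cost c + max_cost d + 1"
| "max_cost (CWhile e c) = 0"

lemma exec_loop_free:
  assumes "loop_free c"
  obtains t where "exec c s t (run c s)" "t \<le> max_cost c"
proof -
  have "\<exists>t. exec c s t (run c s) \<and> t \<le> max_cost c"
    using assms
  proof (induction c arbitrary: s)
    case CSkip
    then show ?case using exec.Skip[of s] by auto
  next
    case (CSet r a)
    then show ?case using exec.Set[of r a s] by auto
  next
    case (CStore a a')
    then show ?case using exec.Store[of a a' s] by auto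
  next
    case (CSeq c d)
    from CSeq.IH(1)[of s] CSeq.prems obtain t where t: "exec c s t (run c s)" "t \<le> max_cost c" by auto
    from CSeq.IH(2)[of "run c s"] CSeq.prems obtain u
      where u: "exec d (run c s) u (run d (run c s))" "u \<le> max_cost d" by auto
    show ?case using exec.Seq[OF t(1) u(1)] t(2) u(2) by (intro exI[of _ "t + u"]) simp
  next
    case (CIf e c d)
    show ?case
    proof (cases "bval e s")
      case True
      from CIf.IH(1)[of s] CIf.prems obtain t where t: "exec c s t (run c s)" "t \<le> max_cost c" by auto
      show ?thesis using exec.IfTrue[OF True t(1), of d] t(2) True
        by (intro exI[of _ "bcost e + t + 1"]) simp
    next
      case False
      from CIf.IH(2)[of s] CIf.prems obtain t where t: "exec d s t (run d s)" "t \<le> max_cost d" by auto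
      show ?thesis using exec.IfFalse[OF False t(1), of c] t(2) False
        by (intro exI[of _ "bcost e + t + 1"]) simp
    qed
  qed simp
  then show thesis using that by blast
qed

text \<open>Total correctness by an invariant and a decreasing measure: there are at most
  \<open>m s\<close> iterations, and the additional 1 pays for the final test.\<close>

lemma exec_while:
  fixes m :: "state \<Rightarrow> nat"
  assumes "loop_free c"
    and step: "\<And>s. I s \<Longrightarrow> bval e s \<Longrightarrow> I (run c s) \<and> m (run c s) < m s"
    and "I s"
  obtains t s' where "exec (CWhile e c) s t s'" "I s'" "\<not> bval e s'"
    "t \<le> (m s + 1) * (bcost e + max_cost c + 1)"
proof -
  let ?K = "bcost e + max_cost c + 1"
  have "\<exists>t s'. exec (CWhile e c) s t s' \<and> I s' \<and> \<not> bval e s' \<and> t \<le> (m s + 1) * ?K"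
    using \<open>I s\<close>
  proof (induction "m s" arbitrary: s rule: less_induct)
    case less
    show ?case
    proof (cases "bval e s")
      case False
      then show ?thesis using exec.WhileFalse[OF False, of c] less.prems
        by (intro exI[of _ "bcost e + 1"] exI[of _ s]) simp
    next
      case True
      obtain t where t: "exec c s t (run c s)" "t \<le> max_cost c"
        using exec_loop_free[OF assms(1)] .
      have dec: "I (run c s)" "m (run c s) < m s" using step[OF less.prems True] by auto
      from less.hyps[OF dec(2,1)] obtain u s' where
        u: "exec (CWhile e c) (run c s) u s'" "I s'" "\<not> bval e s'" "u \<le> (m (run c s) + 1) * ?K" by blast
      have "u \<le> m s * ?K" using u(4) mult_le_mono1[of "m (run c s) + 1" "m s" ?K] dec(2) by simp
      then have "bcost e + t + u + 1 \<le> (m s + 1) * ?K" using t(2) by simp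
      then show ?thesis using exec.WhileTrue[OF True t(1) u(1)] u(2,3) by blast
    qed
  qed
  then show thesis using that by blast
qed

section \<open>The program\<close>

text \<open>
  Registers: 0 holds \<open>n\<close>, 2 the address \<open>n\<^sup>2\<close>, 3 the current vertex (0 is the virtual root),
  4 the candidate \<open>w\<close> for its next child, 5 the address of the row of \<open>w\<close> in the adjacency matrix,
  6 the largest span and 7 the lower end of the edge attaining it; 8 is a counter.
  The parent of \<open>v\<close> is stored at \<open>n\<^sup>2 + v\<close>, its depth at \<open>n\<^sup>2 + n + 1 + v\<close>.
  There is no multiplication, so the matrix is read in the row of \<open>w\<close>, whose address grows along with \<open>w\<close>.
  At the virtual root the adjacency test reads an unrelated cell; this is harmless, as the root has depth 0.
\<close>

definition square_body :: com where
  "square_body = CSeq (CSet 2 (AAdd (AReg 2) (AReg 0))) (CSet 8 (AAdd (AReg 8) (AConst 1)))"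

definition par_addr :: "aexp \<Rightarrow> aexp" where
  "par_addr a = AAdd (AReg 2) a"

definition dep_addr :: "aexp \<Rightarrow> aexp" where
  "dep_addr a = AAdd (AAdd (AReg 2) (AReg 0)) (AAdd (AConst 1) a)"

definition adj_test :: bexp where
  "adj_test = BEq (AMem (ASub (AAdd (AReg 5) (AReg 3)) (AConst 1))) (AConst 1)"

definition restart_scan :: com where
  "restart_scan = CSeq (CSet 4 (AConst 1)) (CSet 5 (AConst 0))"

definition next_candidate :: com where
  "next_candidate = CSeq (CSet 4 (AAdd (AReg 4) (AConst 1))) (CSet 5 (AAdd (AReg 5) (AReg 0)))"

definition pop_code :: com where
  "pop_code = CSeq (CSet 3 (AMem (par_addr (AReg 3)))) restart_scan"

definition push_code :: com where
  "push_code =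
     CSeq (CStore (par_addr (AReg 4)) (AReg 3))
    (CSeq (CStore (dep_addr (AReg 4)) (AAdd (AMem (dep_addr (AReg 3))) (AConst 1)))
    (CSeq (CSet 3 (AReg 4)) restart_scan))"

definition record_code :: com where
  "record_code =
     CSeq (CSet 6 (ASub (AMem (dep_addr (AReg 3))) (AMem (dep_addr (AReg 4))))) (CSet 7 (AReg 3))"

definition dfs_body :: com where
  "dfs_body =
     CIf (BLess (AReg 0) (AReg 4)) pop_code
    (CIf (BEq (AMem (dep_addr (AReg 4))) (AConst 0))
      (CIf (BAnd (BNot (BEq (AReg 3) (AConst 0))) (BNot adj_test)) next_candidate push_code)
      (CSeq
        (CIf (BAnd adj_test
            (BLess (AReg 6) (ASub (AMem (dep_addr (AReg 3))) (AMem (dep_addr (AReg 4))))))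
          record_code CSkip)
        next_candidate))"

definition dfs_guard :: bexp where
  "dfs_guard = BNot (BAnd (BEq (AReg 3) (AConst 0)) (BLess (AReg 0) (AReg 4)))"

text \<open>The output area starts directly behind the depth table, whose last address is
  \<open>n * n + 2 * n + 1\<close>. A span of \<open>b\<close> gives \<open>b + 1\<close>
  entries.\<close>

definition output_init :: com where
  "output_init =
     CSeq (CSet 1 (AAdd (AReg 2) (AAdd (AReg 0) (AAdd (AReg 0) (AConst 2)))))
    (CSeq (CSet 0 (AAdd (AReg 6) (AConst 1))) (CSet 8 (AConst 0)))"

definition output_body :: com where
  "output_body =
     CSeq (CStore (AAdd (AReg 1) (AReg 8)) (AReg 7))
    (CSeq (CSet 7 (AMem (par_addr (AReg 7)))) (CSet 8 (AAdd (AReg 8) (AConst 1))))"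

definition long_cycle_program :: com where
  "long_cycle_program =
     CSeq (CWhile (BLess (AReg 8) (AReg 0)) square_body)
    (CSeq (CSet 4 (AConst 1))
    (CSeq (CWhile dfs_guard dfs_body)
    (CSeq output_init
      (CWhile (BLess (AReg 8) (AReg 0)) output_body))))"

section \<open>Correctness and running time of the loops\<close>

lemma square_loop:
  obtains t where
    "exec (CWhile (BLess (AReg 8) (AReg 0)) square_body) ((\<lambda>r. if r = 0 then n else 0), m) t
       ((\<lambda>_. 0)(0 := n, 2 := n * n, 8 := n), m)"
    "t \<le> (n + 1) * (bcost (BLess (AReg 8) (AReg 0)) + max_cost square_body + 1)"
proof -
  let ?s = "\<lambda>k. ((\<lambda>_. 0)(0 := n, 2 := k * n, 8 := k) :: nat \<Rightarrow> nat, m)"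
  let ?I = "\<lambda>s. \<exists>k\<le>n. s = ?s k"
  have init: "((\<lambda>r. if r = 0 then n else 0), m) = ?s 0" by (auto simp: fun_eq_iff)
  have lf: "loop_free square_body" by (simp add: square_body_def)
  obtain t s' where t: "exec (CWhile (BLess (AReg 8) (AReg 0)) square_body) (?s 0) t s'"
    "?I s'" "\<not> bval (BLess (AReg 8) (AReg 0)) s'"
    "t \<le> ((\<lambda>s. n - fst s 8) (?s 0) + 1) * (bcost (BLess (AReg 8) (AReg 0)) + max_cost square_body + 1)"
  proof (rule exec_while[OF lf, of ?I "BLess (AReg 8) (AReg 0)" "\<lambda>s. n - fst s 8" "?s 0"])
    fix s assume "?I s" and less: "bval (BLess (AReg 8) (AReg 0)) s"
    then obtain k where k: "k \<le> n" "s = ?s k" by blast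
    then have "run square_body s = ?s (Suc k)" by (auto simp: square_body_def fun_eq_iff)
    moreover have "k < n" using less k by simp
    ultimately show "?I (run square_body s) \<and> n - fst (run square_body s) 8 < n - fst s 8"
      using k by (intro conjI exI[of _ "Suc k"]) auto
  qed auto
  then have "s' = ?s n" by auto
  then show thesis using t that init by simp
qed

text \<open>Beyond \<open>n\<close> the addresses run into the depth table. The cut-off to 0 makes
  storing a parent and a depth a function update of \<open>mem_par\<close> at a single
  vertex.\<close>

definition mem_par :: "nat \<Rightarrow> (nat \<Rightarrow> nat) \<Rightarrow> nat \<Rightarrow> nat" where
  "mem_par n m v = (if v \<le> n then m (n * n + v) else 0)"

definition mem_dep :: "nat \<Rightarrow> (nat \<Rightarrow> nat) \<Rightarrow> nat \<Rightarrow> nat" where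
  "mem_dep n m v = m (n * n + n + Suc v)"

definition dfs_inv :: "nat \<Rightarrow> (nat \<times> nat) set \<Rightarrow> state \<Rightarrow> bool" where
  "dfs_inv n E s \<longleftrightarrow> fst s 0 = n \<and> fst s 2 = n * n \<and> fst s 5 = (fst s 4 - 1) * n \<and>
     (\<forall>a<n * n. snd s a = snd (graph_input n E) a) \<and>
     dfs_state n E (mem_par n (snd s)) (mem_dep n (snd s)) (fst s 3) (fst s 4) (fst s 6) (fst s 7)"

text \<open>A push trades an unvisited vertex, worth 2, for one more level of depth, and a pop loses
  a level. Either lowers the first factor by 1, and the weight \<open>n + 2\<close> exceeds the at
  most \<open>n\<close> regained by resetting \<open>w\<close>; otherwise \<open>w\<close>
  grows.\<close>

definition dfs_measure :: "nat \<Rightarrow> state \<Rightarrow> nat" where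
  "dfs_measure n s =
     (2 * card {v \<in> {1..n}. mem_dep n (snd s) v = 0} + mem_dep n (snd s) (fst s 3)) * (n + 2)
       + (Suc n - fst s 4)"

lemma graph_input_adj:
  assumes "u \<in> {1..n}" "v \<in> {1..n}"
  shows "(u - 1) * n + v - 1 < n * n"
    "snd (graph_input n E) ((u - 1) * n + v - 1) = 1 \<longleftrightarrow> (u, v) \<in> E"
proof -
  obtain x y where xy: "u = Suc x" "v = Suc y" "x < n" "y < n"
    using assms by (metis Suc_le_D Suc_le_eq atLeastAtMost_iff One_nat_def)
  have "x * n + y < Suc x * n" using xy by simp
  also have "\<dots> \<le> n * n" using xy by (intro mult_right_mono) auto
  finally have a: "x * n + y < n * n" .
  then show "(u - 1) * n + v - 1 < n * n" using xy by simp
  show "snd (graph_input n E) ((u - 1) * n + v - 1) = 1 \<longleftrightarrow> (u, v) \<in> E"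
    using xy a by (simp add: graph_input_def)
qed

text \<open>Each path through the code realises one abstract transition: \<open>pop\<close>,
  \<open>advance\<close>, \<open>push\<close>, or \<open>record_span\<close> followed by
  \<open>advance\<close>.\<close>

lemma dfs_body_step:
  assumes inv: "dfs_inv n E s" and guard: "bval dfs_guard s"
  shows "dfs_inv n E (run dfs_body s) \<and> dfs_measure n (run dfs_body s) < dfs_measure n s"
proof -
  define R where "R = fst s"
  define m where "m = snd s"
  have s: "s = (R, m)" by (simp add: R_def m_def)
  define cur w b vb where "cur = R 3" and "w = R 4" and "b = R 6" and "vb = R 7"
  note regs = cur_def w_def b_def vb_def
  have R: "R 0 = n" "R 2 = n * n" "R 5 = (w - 1) * n"
    and mem: "\<And>a. a < n * n \<Longrightarrow> m a = snd (graph_input n E) a"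
    and st: "dfs_state n E (mem_par n m) (mem_dep n m) cur w b vb"
    using inv by (auto simp: dfs_inv_def s regs)
  interpret dfs_state n E "mem_par n m" "mem_dep n m" cur w b vb by (fact st)
  have cur_le: "cur \<le> n" using vis_cur by (simp add: vis_def)
  let ?adj = "m ((w - 1) * n + cur - 1) = 1"
  have adj: "?adj \<longleftrightarrow> (cur, w) \<in> E" if "w \<le> n" "cur \<noteq> 0"
  proof -
    have "w \<in> {1..n}" "cur \<in> {1..n}" using that w_ge cur_le by auto
    from graph_input_adj[OF this] mem show ?thesis using edge_sym by auto
  qed
  have adj_val: "bval adj_test s \<longleftrightarrow> ?adj"
    by (simp add: adj_test_def s R flip: cur_def)
  have dep_val: "aval (AMem (dep_addr (AReg r))) s = mem_dep n m (R r)" for r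
    by (simp add: dep_addr_def s R mem_dep_def)
  have row: "(w - 1) * n + n = w * n" using w_ge by (cases w) auto
  consider (pop_case) "n < w" | (skip) "w \<le> n" "mem_dep n m w = 0" "cur \<noteq> 0" "\<not> ?adj"
    | (push_case) "w \<le> n" "mem_dep n m w = 0" "cur = 0 \<or> ?adj"
    | (record_case) "w \<le> n" "mem_dep n m w \<noteq> 0" "?adj" "b < mem_dep n m cur - mem_dep n m w"
    | (no_record) "w \<le> n" "mem_dep n m w \<noteq> 0" "\<not> (?adj \<and> b < mem_dep n m cur - mem_dep n m w)"
    by linarith
  then show ?thesis
  proof cases
    case pop_case
    then have w: "w = Suc n" using w_le by simp
    have "cur \<noteq> 0" using guard pop_case by (simp add: dfs_guard_def s R regs)
    note p = pop[OF w this]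
    have run: "run dfs_body s = (R(3 := mem_par n m cur, 4 := 1, 5 := 0), m)"
      using pop_case cur_le
      by (simp add: dfs_body_def pop_code_def restart_scan_def par_addr_def s R mem_par_def flip: w_def cur_def)
    show ?thesis unfolding run dfs_measure_def dfs_inv_def
      using p R mem w by (simp add: s flip: regs)
  next
    case skip
    then have run: "run dfs_body s = (R(4 := Suc w, 5 := w * n), m)"
      using adj_val dep_val row
      by (simp add: dfs_body_def next_candidate_def s R flip: w_def cur_def)
    have "dfs_state n E (mem_par n m) (mem_dep n m) cur (Suc w) b vb"
      using skip adj by (intro advance) auto
    then show ?thesis unfolding run dfs_measure_def dfs_inv_def
      using R mem skip by (simp add: s flip: regs)
  next
    case push_case
    define m' where "m' = m(n * n + w := cur, n * n + n + Suc w := Suc (mem_dep n m cur))"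
    have run: "run dfs_body s = (R(3 := w, 4 := 1, 5 := 0), m')"
      using push_case adj_val dep_val
      by (auto simp: dfs_body_def push_code_def restart_scan_def par_addr_def dep_addr_def
          s R mem_dep_def m'_def simp flip: w_def cur_def)
    have par': "mem_par n m' = (mem_par n m)(w := cur)"
      and dep': "mem_dep n m' = (mem_dep n m)(w := Suc (mem_dep n m cur))"
      using push_case(1) by (auto simp: mem_par_def mem_dep_def m'_def fun_eq_iff)
    have "cur = 0 \<or> (cur, w) \<in> E" using push_case adj by auto
    note p = push[OF push_case(1,2) this]
    let ?U = "{v \<in> {1..n}. mem_dep n m v = 0}"
    have U: "{v \<in> {1..n}. mem_dep n m' v = 0} = ?U - {w}" using dep' by auto
    have "finite ?U" "w \<in> ?U" using push_case w_ge by auto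
    then have card: "card ?U = Suc (card {v \<in> {1..n}. mem_dep n m' v = 0})"
      unfolding U by (rule card.remove)
    have mem': "m' a = snd (graph_input n E) a" if "a < n * n" for a
      using that mem by (simp add: m'_def)
    have "dfs_inv n E (run dfs_body s)" unfolding run dfs_inv_def
      using p R mem' by (simp add: par' dep' flip: regs)
    moreover define q where "q = card {v \<in> {1..n}. mem_dep n m' v = 0}"
    have "dfs_measure n (run dfs_body s) = (2 * q + Suc (mem_dep n m cur)) * (n + 2) + n"
      unfolding run dfs_measure_def q_def by (simp add: dep')
    moreover have "dfs_measure n s = (2 * Suc q + mem_dep n m cur) * (n + 2) + (Suc n - w)"
      using card unfolding dfs_measure_def s fst_conv snd_conv q_def regs by (simp only:)
    ultimately show ?thesis by simp
  next
    case record_case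
    \<comment> \<open>At the virtual root the adjacency test is meaningless, but depth 0 leaves no
      positive span to record.\<close>
    have "cur \<noteq> 0" using record_case dep_0 by (metis diff_0_eq_0 not_less_zero)
    then have edge: "(cur, w) \<in> E" using record_case adj by simp
    have run: "run dfs_body s = (R(6 := mem_dep n m cur - mem_dep n m w, 7 := cur, 4 := Suc w, 5 := w * n), m)"
      using record_case adj_val dep_val row
      by (simp add: dfs_body_def record_code_def next_candidate_def s R flip: regs)
    interpret rec: dfs_state n E "mem_par n m" "mem_dep n m" cur w "mem_dep n m cur - mem_dep n m w" cur
      using record_case edge by (intro record_span) auto
    have "dfs_state n E (mem_par n m) (mem_dep n m) cur (Suc w) (mem_dep n m cur - mem_dep n m w) cur"
      using record_case by (intro rec.advance) auto
    then show ?thesis unfolding run dfs_measure_def dfs_inv_def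
      using R mem record_case by (simp add: s flip: regs)
  next
    case no_record
    have run: "run dfs_body s = (R(4 := Suc w, 5 := w * n), m)"
      using no_record adj_val dep_val row
      by (auto simp: dfs_body_def next_candidate_def s R simp flip: regs)
    have "dfs_state n E (mem_par n m) (mem_dep n m) cur (Suc w) b vb"
    proof (rule advance)
      show "0 < mem_dep n m w \<and> mem_dep n m cur - mem_dep n m w \<le> b" if "cur = 0 \<or> (cur, w) \<in> E"
        using no_record adj dep_0 that by (cases "cur = 0") auto
    qed (fact no_record)
    then show ?thesis unfolding run dfs_measure_def dfs_inv_def
      using R mem no_record by (simp add: s flip: regs)
  qed
qed

lemma dfs_loop:
  assumes "simple_graph n E"
  obtains t s where
    "exec (CWhile dfs_guard dfs_body)
       ((\<lambda>_. 0)(0 := n, 2 := n * n, 8 := n, 4 := 1), snd (graph_input n E)) t s"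
    "dfs_inv n E s" "\<not> bval dfs_guard s"
    "t \<le> (2 * n * (n + 2) + n + 1) * (bcost dfs_guard + max_cost dfs_body + 1)"
proof -
  let ?m = "snd (graph_input n E)"
  let ?s = "((\<lambda>_. 0)(0 := n, 2 := n * n, 8 := n, 4 := 1) :: nat \<Rightarrow> nat, ?m)"
  have zero: "mem_par n ?m = (\<lambda>_. 0)" "mem_dep n ?m = (\<lambda>_. 0)"
    by (auto simp: mem_par_def mem_dep_def graph_input_def fun_eq_iff)
  have inv: "dfs_inv n E ?s"
    using dfs_state_initial[OF assms] by (simp add: dfs_inv_def zero)
  have "loop_free dfs_body"
    by (simp add: dfs_body_def pop_code_def push_code_def record_code_def next_candidate_def restart_scan_def)
  then obtain t s where t: "exec (CWhile dfs_guard dfs_body) ?s t s" "dfs_inv n E s" "\<not> bval dfs_guard s"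
    "t \<le> (dfs_measure n ?s + 1) * (bcost dfs_guard + max_cost dfs_body + 1)"
    using exec_while[of dfs_body "dfs_inv n E" dfs_guard "dfs_measure n" ?s] dfs_body_step inv by metis
  have "{v \<in> {1..n}. mem_dep n ?m v = 0} = {1..n}" by (auto simp: zero)
  then have "dfs_measure n ?s = 2 * n * (n + 2) + n"
    by (simp only: dfs_measure_def snd_conv) (simp add: zero)
  then show thesis using t that by simp
qed

text \<open>All writes go to addresses from \<open>n * n + 2 * n + 2\<close> on, so the parent table
  stays intact while the path is copied.\<close>

lemma output_loop:
  fixes s :: state and b v n :: nat
  assumes R: "fst s 0 = Suc b" "fst s 1 = n * n + 2 * n + 2" "fst s 2 = n * n" "fst s 7 = v" "fst s 8 = 0"
    and "v \<le> n" and par: "\<And>u. u \<le> n \<Longrightarrow> mem_par n (snd s) u \<le> n"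
  obtains t s' where "exec (CWhile (BLess (AReg 8) (AReg 0)) output_body) s t s'"
    "list_output s' = map (\<lambda>k. (mem_par n (snd s) ^^ k) v) [0..<Suc b]"
    "t \<le> (b + 2) * (bcost (BLess (AReg 8) (AReg 0)) + max_cost output_body + 1)"
proof -
  let ?par = "mem_par n (snd s)"
  let ?B = "n * n + 2 * n + 2"
  let ?e = "BLess (AReg 8) (AReg 0)"
  define I where "I s' \<longleftrightarrow> fst s' 0 = Suc b \<and> fst s' 1 = ?B \<and> fst s' 2 = n * n \<and>
    fst s' 8 \<le> Suc b \<and> fst s' 7 = (?par ^^ fst s' 8) v \<and> (\<forall>a<?B. snd s' a = snd s a) \<and>
    (\<forall>i<fst s' 8. snd s' (?B + i) = (?par ^^ i) v)" for s' :: state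
  have pow: "(?par ^^ k) v \<le> n" for k
    by (induction k) (use \<open>v \<le> n\<close> par in auto)
  have init: "I s" using R by (simp add: I_def)
  have lf: "loop_free output_body" by (simp add: output_body_def)
  have step: "I (run output_body s') \<and> Suc b - fst (run output_body s') 8 < Suc b - fst s' 8"
    if "I s'" "bval ?e s'" for s'
  proof -
    define R' m' k where "R' = fst s'" and "m' = snd s'" and "k = R' 8"
    have s': "s' = (R', m')" by (simp add: R'_def m'_def)
    have I: "R' 0 = Suc b" "R' 1 = ?B" "R' 2 = n * n" "R' 8 = k" "R' 7 = (?par ^^ k) v"
      "\<And>a. a < ?B \<Longrightarrow> m' a = snd s a" "\<And>i. i < k \<Longrightarrow> m' (?B + i) = (?par ^^ i) v"
      using that(1) by (auto simp: I_def s' k_def)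
    have k: "k \<le> b" using that(2) I by (simp add: s')
    have addr: "n * n + (?par ^^ k) v < ?B" using pow[of k] by simp
    then have "m' (n * n + (?par ^^ k) v) = ?par ((?par ^^ k) v)"
      using I(6) pow[of k] by (simp add: mem_par_def[of n "snd s" "(?par ^^ k) v"])
    then have run: "run output_body s' =
        (R'(7 := (?par ^^ Suc k) v, 8 := Suc k), m'(?B + k := (?par ^^ k) v))"
      using addr I by (simp add: output_body_def par_addr_def s')
    show ?thesis unfolding run using I k
      by (auto simp: I_def s' less_Suc_eq)
  qed
  obtain t s' where t: "exec (CWhile ?e output_body) s t s'" "I s'" "\<not> bval ?e s'"
    "t \<le> (Suc b - fst s 8 + 1) * (bcost ?e + max_cost output_body + 1)"
    using exec_while[of output_body I ?e "\<lambda>s. Suc b - fst s 8" s] lf step init by metis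
  have "fst s' 8 = Suc b" using t(2,3) by (auto simp: I_def)
  then have "list_output s' = map (\<lambda>k. (?par ^^ k) v) [0..<Suc b]"
    using t(2) by (simp add: I_def list_output_def del: upt_Suc)
  then show thesis using t that R by simp
qed

text \<open>The summands are the five phases in order. \<open>[:1, 5, 2:]\<close> is the initial
  measure \<open>2 * n * (n + 2) + n\<close> plus 1, and \<open>[:2, 1:]\<close> bounds the output
  loop through \<open>b \<le> n\<close>.\<close>

definition running_time :: "nat poly" where
  "running_time =
     (let e = BLess (AReg 8) (AReg 0) in
      smult (bcost e + max_cost square_body + 1) [:1, 1:] + [:max_cost (CSet 4 (AConst 1)):] +
      smult (bcost dfs_guard + max_cost dfs_body + 1) [:1, 5, 2:] + [:max_cost output_init:] +
      smult (bcost e + max_cost output_body + 1) [:2, 1:])"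

lemma long_cycle_program_correct:
  assumes "simple_graph n E"
  obtains t s par dep b v where "exec long_cycle_program (graph_input n E) t s"
    "t \<le> poly running_time n" "dfs_forest n E par dep b"
    "list_output s = map (\<lambda>k. (par ^^ k) v) [0..<Suc b]"
    "0 < b \<Longrightarrow> parent_forest.vis n dep v \<and>
      (\<exists>u. (v, u) \<in> E \<and> 0 < dep u \<and> parent_forest.anc par dep u v \<and> dep v - dep u = b)"
proof -
  let ?e = "BLess (AReg 8) (AReg 0)" and ?m = "snd (graph_input n E)"
  have input: "graph_input n E = ((\<lambda>r. if r = 0 then n else 0), ?m)"
    by (simp add: graph_input_def)
  obtain t1 where t1: "exec (CWhile ?e square_body) (graph_input n E) t1
       ((\<lambda>_. 0)(0 := n, 2 := n * n, 8 := n), ?m)"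
    "t1 \<le> (n + 1) * (bcost ?e + max_cost square_body + 1)"
    using square_loop[of n ?m] input by metis
  obtain t2 where t2: "exec (CSet 4 (AConst 1)) ((\<lambda>_. 0)(0 := n, 2 := n * n, 8 := n), ?m) t2
       ((\<lambda>_. 0)(0 := n, 2 := n * n, 8 := n, 4 := 1), ?m)" "t2 \<le> max_cost (CSet 4 (AConst 1))"
    using exec_loop_free[of "CSet 4 (AConst 1)" "((\<lambda>_. 0)(0 := n, 2 := n * n, 8 := n), ?m)"] by auto
  obtain t3 s3 where t3: "exec (CWhile dfs_guard dfs_body)
       ((\<lambda>_. 0)(0 := n, 2 := n * n, 8 := n, 4 := 1), ?m) t3 s3"
    "dfs_inv n E s3" "\<not> bval dfs_guard s3"
    "t3 \<le> (2 * n * (n + 2) + n + 1) * (bcost dfs_guard + max_cost dfs_body + 1)"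
    using dfs_loop[OF assms] .
  define par dep b v where "par = mem_par n (snd s3)" and "dep = mem_dep n (snd s3)"
    and "b = fst s3 6" and "v = fst s3 7"
  interpret dfs_state n E par dep "fst s3 3" "fst s3 4" b v
    using t3(2) by (simp add: dfs_inv_def par_def dep_def b_def v_def)
  have n: "fst s3 0 = n" "fst s3 2 = n * n" using t3(2) by (simp_all add: dfs_inv_def)
  then have "fst s3 3 = 0" "fst s3 4 = Suc n"
    using t3(3) w_le by (auto simp: dfs_guard_def)
  then have forest: "dfs_forest n E par dep b" by (intro dfs_forest_final)
  \<comment> \<open>A positive span is attained at a visited vertex, whose depth is at most
    \<open>n\<close>.\<close>
  have b_le: "b \<le> n"
  proof (cases "b = 0")
    case False
    then obtain u where "vis v" "dep v - dep u = b" using witness by auto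
    then show ?thesis using dep_le[of v] by linarith
  qed simp
  define s4 where "s4 = run output_init s3"
  have lf: "loop_free output_init" by (simp add: output_init_def)
  obtain t4 where t4: "exec output_init s3 t4 s4" "t4 \<le> max_cost output_init"
    unfolding s4_def using exec_loop_free[OF lf] .
  have s4: "fst s4 0 = Suc b" "fst s4 1 = n * n + 2 * n + 2" "fst s4 2 = n * n" "fst s4 7 = v"
    "fst s4 8 = 0" "snd s4 = snd s3"
    by (simp_all add: s4_def output_init_def n b_def v_def)
  have "mem_par n (snd s4) u \<le> n" if "u \<le> n" for u
    using par_le[OF that] by (simp add: s4 par_def)
  from output_loop[OF s4(1-5) v\<^sub>b_le this]
  obtain t5 s5 where t5: "exec (CWhile ?e output_body) s4 t5 s5"
    "list_output s5 = map (\<lambda>k. (mem_par n (snd s4) ^^ k) v) [0..<Suc b]"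
    "t5 \<le> (b + 2) * (bcost ?e + max_cost output_body + 1)" by metis
  let ?t = "t1 + (t2 + (t3 + (t4 + t5)))"
  have "exec long_cycle_program (graph_input n E) ?t s5"
    unfolding long_cycle_program_def by (intro exec.Seq) (fact t1 t2 t3 t4 t5)+
  moreover have "?t \<le> poly running_time n"
  proof -
    have "t5 \<le> (n + 2) * (bcost ?e + max_cost output_body + 1)"
      using b_le by (intro le_trans[OF t5(3)] mult_le_mono1) simp
    then have "?t \<le> (n + 1) * (bcost ?e + max_cost square_body + 1) + (max_cost (CSet 4 (AConst 1)) +
       ((2 * n * (n + 2) + n + 1) * (bcost dfs_guard + max_cost dfs_body + 1) +
       (max_cost output_init + (n + 2) * (bcost ?e + max_cost output_body + 1))))"
      by (intro add_mono t1(2) t2(2) t3(4) t4(2))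
    also have "\<dots> = poly running_time n"
      by (simp add: running_time_def Let_def algebra_simps)
    finally show ?thesis .
  qed
  ultimately show thesis
    using that[of ?t s5 par dep b v] forest t5(2) witness by (simp add: par_def s4)
qed

theorem theorem1p6:
  "\<exists>P. polynomial_time P \<and>
     (\<forall>(\<epsilon>::real) (\<tau>::nat) (D::nat) (n::nat) (E::(nat \<times> nat) set).
        0 < \<epsilon> \<and> \<epsilon> < 2 / 5 \<and> 0 < \<tau> \<and> 1 \<le> D \<and> 1 \<le> n \<and> regular_graph n D E \<and>
        real (card {v \<in> {1..n}. tv_dist n (walk E \<tau> v) (pmf_of_set {1..n}) < 1 / 30})
          \<ge> \<epsilon> * real n \<longrightarrow>
        (\<exists>C. is_cycle E C \<and> real (length C) > \<epsilon> * real n / (40 * real \<tau>)) \<and>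
        (\<exists>C. returns P n E C \<and> is_cycle E C \<and>
             real (length C) > \<epsilon> * real n / (40 * real \<tau>)))"
proof -
  have poly: "polynomial_time long_cycle_program"
    unfolding polynomial_time_def using long_cycle_program_correct by metis
  have cycle: "\<exists>C. returns long_cycle_program n E C \<and> is_cycle E C \<and>
      real (length C) > \<epsilon> * real n / (40 * real \<tau>)"
    if "0 < \<epsilon>" "\<epsilon> < 2 / 5" "0 < \<tau>" "1 \<le> D" "1 \<le> n" "regular_graph n D E"
      "real (card {v \<in> {1..n}. tv_dist n (walk E \<tau> v) (pmf_of_set {1..n}) < 1 / 30}) \<ge> \<epsilon> * real n"
    for \<epsilon> :: real and \<tau> D n :: nat and E
  proof -
    have graph: "simple_graph n E" using that(6) by (simp add: regular_graph_def)
    obtain t s par dep b v where t: "exec long_cycle_program (graph_input n E) t s"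
      and forest: "dfs_forest n E par dep b"
      and out: "list_output s = map (\<lambda>k. (par ^^ k) v) [0..<Suc b]"
      and wit: "0 < b \<Longrightarrow> parent_forest.vis n dep v \<and>
      (\<exists>u. (v, u) \<in> E \<and> 0 < dep u \<and> parent_forest.anc par dep u v \<and> dep v - dep u = b)"
      using long_cycle_program_correct[OF graph] by metis
    interpret dfs_forest n E par dep b by (fact forest)
    \<comment> \<open>Mixing enters only here, in the analysis: the program depends on none of
      \<open>\<epsilon>\<close>, \<open>\<tau>\<close> and \<open>D\<close>.\<close>
    have b: "2 \<le> b" "real (Suc b) > \<epsilon> * real n / (40 * real \<tau>)"
      using long_span[OF that] by auto
    then obtain u where "vis v" "(v, u) \<in> E" "0 < dep u" "anc u v" "dep v - dep u = b"
      using wit by auto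
    then have "is_cycle E (list_output s)"
      unfolding out using graph b by (intro is_cycle_par_path) (auto simp: simple_graph_def)
    moreover have "length (list_output s) = Suc b" by (simp add: out)
    moreover have "returns long_cycle_program n E (list_output s)"
      unfolding returns_def using t by blast
    ultimately show ?thesis using b by (intro exI[of _ "list_output s"]) simp
  qed
  show ?thesis
  \<comment> \<open>The cycle returned by the program also settles the existence claim.\<close>
  proof ((intro exI[of _ long_cycle_program] conjI poly allI impI; elim conjE), goal_cases)
    case 1
    from cycle[OF this] show ?case by (elim exE conjE) (intro exI conjI)
  next
    case 2
    then show ?case by (rule cycle)
  qed
qed

end
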